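(* Let $f(t),g(t)\in\mathbb{C}[[t]]$ be a delta series and an invertible series respectively, and let $r\ge 1$ be an integer. For every $n\ge0$, the Legendre-Gould Hopper based Sheffer polynomials satisfy $${}_{{}_{s}LeG^{(r)}}s_{n}(x,y,z)=\int_{0}^{\infty} e^{-s}\;{}_{{}_{s}LeG^{(r)}}s_{n}(x,y,sD_{z}^{-1})\,ds.$$
   Context: A delta series is $f\in\mathbb{C}[[t]]$ with $f(0)=0$, $f'(0)\neq 0$; $f^{-1}$ denotes its compositional inverse. An invertible series is $g\in\mathbb{C}[[t]]$ with $g(0)\ne 0$. $C_0(x)=\sum_{k\ge 0}\frac{(-1)^k x^k}{(k!)^2}$. $D_z^{-1}$ is the inverse derivative operator in $z$, $D_z^{-1}h=\int_0^z h\,d\zeta$, so $D_z^{-k}\{1\}=z^k/k!$. For a polynomial $p(x,y,z)=\sum_k p_k(x,y)z^k$, the expression $p(x,y,sD_z^{-1})$ means the operator obtained by substituting $sD_z^{-1}$ for $z$, applied to the constant $1$: $p(x,y,sD_z^{-1})=\sum_k p_k(x,y)s^kD_z^{-k}\{1\}=\sum_k p_k(x,y)\frac{s^kz^k}{k!}$. The polynomials are determined by the generating function $$\frac{1}{g(f^{-1}(t))}\,C_0\!\left(-x\,(f^{-1}(t))^2\right)\exp\!\left(y f^{-1}(t)+z\,(f^{-1}(t))^r\right)=\sum_{n=0}^{\infty}{}_{{}_{s}LeG^{(r)}}s_{n}(x,y,z)\frac{t^n}{n!}.$$ *)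

theory Defs
  imports
    "HOL-Computational_Algebra.Computational_Algebra"
    "HOL-Complex_Analysis.Complex_Analysis"
begin

unbundle fps_syntax

definition delta_series :: "complex fps \<Rightarrow> bool" where
  "delta_series f \<longleftrightarrow> f $ 0 = 0 \<and> fps_deriv f $ 0 \<noteq> 0"

definition invertible_series :: "complex fps \<Rightarrow> bool" where
  "invertible_series g \<longleftrightarrow> g $ 0 \<noteq> 0"

definition fps_C0 :: "complex fps" where
  "fps_C0 = Abs_fps (\<lambda>k. (-1) ^ k / (fact k)\<^sup>2)"

text \<open>
  The ring \<open>\<complex>[x][y][z]\<close> is modelled by nested univariate polynomials,
  with \<open>x\<close> innermost and \<open>z\<close> outermost; in particular \<open>coeff p k\<close> is the
  coefficient \<open>p\<^sub>k(x,y)\<close> of \<open>z\<^sup>k\<close>.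
\<close>

type_synonym poly2 = "complex poly poly"
type_synonym poly3 = "complex poly poly poly"

definition const3 :: "complex \<Rightarrow> poly3" where
  "const3 c = [:[:[:c:]:]:]"

definition X3 :: poly3 where "X3 = [:[:[:0, 1:]:]:]"
definition Y3 :: poly3 where "Y3 = [:[:0, 1:]:]"
definition Z3 :: poly3 where "Z3 = [:0, 1:]"

definition eval2 :: "poly2 \<Rightarrow> complex \<Rightarrow> complex \<Rightarrow> complex" where
  "eval2 q x y = poly (poly q [:y:]) x"

definition eval3 :: "poly3 \<Rightarrow> complex \<Rightarrow> complex \<Rightarrow> complex \<Rightarrow> complex" where
  "eval3 p x y z = eval2 (poly p [:[:z:]:]) x y"

text \<open>The coefficientwise embedding of \<open>\<complex>[[t]]\<close> into \<open>\<complex>[x][y][z][[t]]\<close>.\<close>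

definition lift_fps :: "complex fps \<Rightarrow> poly3 fps" where
  "lift_fps h = Abs_fps (\<lambda>n. const3 (h $ n))"

text \<open>
  Here \<^const>\<open>fps_inv\<close> is the compositional and \<^const>\<open>inverse\<close> the multiplicative
  inverse of power series. For a delta series \<open>f\<close> and \<open>r \<ge> 1\<close> both series substituted
  by \<open>oo\<close> have zero constant term, so that the compositions are the usual ones.
\<close>

definition LeG_Sheffer_gf :: "complex fps \<Rightarrow> complex fps \<Rightarrow> nat \<Rightarrow> poly3 fps" where
  "LeG_Sheffer_gf f g r =
     (let u = lift_fps (fps_inv f) in
        lift_fps (inverse (g oo fps_inv f))
        * (lift_fps fps_C0 oo (- fps_const X3 * u\<^sup>2))
        * (lift_fps (fps_exp 1) oo (fps_const Y3 * u + fps_const Z3 * u ^ r)))"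

definition LeG_Sheffer :: "complex fps \<Rightarrow> complex fps \<Rightarrow> nat \<Rightarrow> nat \<Rightarrow> poly3" where
  "LeG_Sheffer f g r n = fact n * LeG_Sheffer_gf f g r $ n"

definition D_inv :: "(complex \<Rightarrow> complex) \<Rightarrow> complex \<Rightarrow> complex" where
  "D_inv h z = contour_integral (linepath 0 z) h"

text \<open>
  The value at \<open>z\<close> of \<open>p(x, y, s D\<^sub>z\<^sup>-\<^sup>1) {1} = \<Sum>\<^sub>k p\<^sub>k(x,y) s\<^sup>k D\<^sub>z\<^sup>-\<^sup>k{1}\<close>.
\<close>

definition subst_D_inv :: "poly3 \<Rightarrow> complex \<Rightarrow> complex \<Rightarrow> complex \<Rightarrow> complex \<Rightarrow> complex" where
  "subst_D_inv p x y s z =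
     (\<Sum>k\<le>degree p. eval2 (coeff p k) x y * s ^ k * (D_inv ^^ k) (\<lambda>_. 1) z)"

end

theory Submission
  imports Defs
begin

text \<open>The identity holds coefficientwise in z for any polynomial \<open>p\<close>. Replacing z
  by \<open>s D_z^{-1}\<close> turns \<open>z^k\<close> into \<open>s^k z^k / k!\<close>, and
  integrating \<open>s^k\<close> against \<open>e^{-s}\<close> over the half-line gives
  \<open>k!\<close>, which cancels the denominator. Linearity over the finitely many powers of z
  finishes the argument. The two ingredients are \<open>D_inv_funpow_one\<close> and
  \<open>has_integral_exp_minus_times_power\<close>.\<close>

lemma eval2_mult: "eval2 (p * q) x y = eval2 p x y * eval2 q x y"
  by (simp add: eval2_def)

lemma eval2_sum: "eval2 (\<Sum>k\<in>A. q k) x y = (\<Sum>k\<in>A. eval2 (q k) x y)"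
  by (simp add: eval2_def poly_sum)

lemma eval2_const_power: "eval2 ([:[:c:]:] ^ k) x y = c ^ k"
  by (simp add: eval2_def)

lemma eval3_altdef: "eval3 p x y z = (\<Sum>k\<le>degree p. eval2 (coeff p k) x y * z ^ k)"
  by (simp add: eval3_def poly_altdef eval2_sum eval2_mult eval2_const_power)

text \<open>The primitive \<open>w ^ Suc k / fact (Suc k)\<close> vanishes at 0, so only the
  endpoint z contributes. Dividing by the factorial makes these monomials a chain under
  \<open>D_inv\<close> starting at 1, ready for iteration.\<close>

lemma D_inv_monomial: "D_inv (\<lambda>w. w ^ k / fact k) z = z ^ Suc k / fact (Suc k)"
proof -
  have "((\<lambda>w. w ^ Suc k / fact (Suc k)) has_field_derivative w ^ k / fact k) (at w within UNIV)"
    for w :: complex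
    by (rule derivative_eq_intros refl | simp add: divide_simps del: of_nat_Suc)+
  from contour_integral_primitive [OF this valid_path_linepath, of 0 z]
  have "((\<lambda>w. w ^ k / fact k) has_contour_integral z ^ Suc k / fact (Suc k)) (linepath 0 z)"
    by simp
  then show ?thesis
    unfolding D_inv_def by (rule contour_integral_unique)
qed

lemma D_inv_funpow_one: "(D_inv ^^ k) (\<lambda>_. 1) = (\<lambda>z. z ^ k / fact k)"
  by (induction k) (simp_all add: D_inv_monomial del: power_Suc fact_Suc)

text \<open>This is Euler's integral for Gamma at \<open>k + 1\<close>, moved from the reals to the
  complex numbers by the bounded linear map \<open>of_real\<close>.\<close>

lemma has_integral_exp_minus_times_power:
  "((\<lambda>s::real. exp (- complex_of_real s) * complex_of_real s ^ k) has_integral fact k) {0..}"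
proof -
  have "((\<lambda>t::real. t powr (real (Suc k) - 1) / exp t) has_integral Gamma (real (Suc k))) {0..}"
    by (rule Gamma_integral_real) simp
  then have "((\<lambda>t::real. t powr (real (Suc k) - 1) / exp t) has_integral fact k) {0..}"
    by (simp add: Gamma_fact)
  \<comment> \<open>The point 0 is discarded: for \<open>k = 0\<close> the integrands differ there,
    since \<open>0 powr 0 = 0\<close> but \<open>0 ^ 0 = 1\<close>.\<close>
  then have "((\<lambda>t::real. exp (- t) * t ^ k) has_integral fact k) {0..}"
    by (rule has_integral_spike_finite [where S = "{0}", rotated 2])
       (auto simp: powr_realpow exp_minus field_simps)
  from has_integral_linear [OF this bounded_linear_of_real [where ?'a = complex]]
  show ?thesis
    by (simp add: o_def exp_of_real [symmetric])
qed

lemma has_integral_exp_minus_times_subst_D_inv: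
  "((\<lambda>s::real. exp (- complex_of_real s) * subst_D_inv p x y (complex_of_real s) z)
     has_integral eval3 p x y z) {0..}"
proof -
  \<comment> \<open>Everything independent of s is gathered into one constant factor per k, so the
    integral can be taken term by term.\<close>
  have "((\<lambda>s::real. \<Sum>k\<le>degree p. (eval2 (coeff p k) x y * z ^ k / fact k)
            * (exp (- complex_of_real s) * complex_of_real s ^ k))
          has_integral (\<Sum>k\<le>degree p. (eval2 (coeff p k) x y * z ^ k / fact k) * fact k)) {0..}"
    by (intro has_integral_sum has_integral_mult_right has_integral_exp_minus_times_power) simp
  then show ?thesis
    by (simp add: subst_D_inv_def D_inv_funpow_one eval3_altdef sum_distrib_left mult_ac)
qed

theorem theorem4p4:
  fixes f g :: "complex fps" and r n :: nat and x y z :: complex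
  assumes "delta_series f"
    and "invertible_series g"
    and "r \<ge> 1"
  shows "((\<lambda>s::real. exp (- complex_of_real s)
              * subst_D_inv (LeG_Sheffer f g r n) x y (complex_of_real s) z)
          has_integral eval3 (LeG_Sheffer f g r n) x y z) {0..}"
  by (rule has_integral_exp_minus_times_subst_D_inv)

end
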